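(* Let $S(u)$ be a graph-convex set-valued function, i.e., $S((1-\lambda)u_0+\lambda u_1)\supseteq(1-\lambda)\cdot S(u_0)+\lambda\cdot S(u_1)$ for all $u_0,u_1$ and $\lambda\in(0,1)$, and let $X$ be a bounded and closed integrable random set. If $S(\cdot)$ is locally bounded (i.e., $S(B)$ is bounded for every bounded set $B$) and continuous, then $S(\mathbb E(X))\supseteq\mathbb E(S(X))$.
   Context: $(\Omega,\mathfrak F,\mathbb P)$ is a complete probability space; sets are subsets of Euclidean spaces; a random set is a map $\Omega\to\mathcal F$ ($\mathcal F$ the closed subsets) measurable for the Borel $\sigma$-algebra on $\mathcal F$. A selection $\xi$ of a random set $X$ is a random vector that almost surely belongs to $X$; it is integrable if $\mathbb E\|\xi\|_1<\infty$. $\mathcal S^1(X)$ is the set of integrable selections; $X$ is integrable if $\mathcal S^1(X)\ne\emptyset$. The (selection) expectation is $\mathbb E(X)=\mathrm{cl}\{\mathbb E\xi:\xi\in\mathcal S^1(X)\}$. "Bounded" is used in the sense for which, on a nonatomic space, $\mathbb E(X)$ is a compact convex set. A set-valued function $S$ assigns to each point $u$ a set $S(u)$; applied to a set $A$ it acts pointwise, $S(A)=\bigcup_{u\in A}S(u)$. $S$ is outer semicontinuous at $\bar u$ if $u_n\to\bar u$, $y_n\in S(u_n)$, $y_n\to y$ imply $y\in S(\bar u)$; inner semicontinuous at $\bar u$ if for every $y\in S(\bar u)$ and every $u_n\to\bar u$ there are $y_n\in S(u_n)$ with $y_n\to y$; continuous if both hold at every point. The sum of sets is the Minkowski sum. 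*)

theory Defs
  imports "HOL-Analysis.Analysis" "HOL-Probability.Probability_Measure"
begin

text \<open>This is the usual topology on the closed sets in random set theory; with \<open>K = {}\<close> its
  underlying space is the family of all closed sets, the empty set included.\<close>

definition fell_topology :: "'a::euclidean_space set topology" where
  "fell_topology = topology_generated_by
     ({{F. closed F \<and> F \<inter> G \<noteq> {}} | G. open G} \<union> {{F. closed F \<and> F \<inter> K = {}} | K. compact K})"

definition fell_borel :: "'a::euclidean_space set measure" where
  "fell_borel = sigma {F. closed F} {U. openin fell_topology U}"

definition random_closed_set :: "'w measure \<Rightarrow> ('w \<Rightarrow> 'a::euclidean_space set) \<Rightarrow> bool" where
  "random_closed_set M X \<longleftrightarrow> X \<in> measurable M fell_borel"

definition l1_norm :: "'a::euclidean_space \<Rightarrow> real" where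
  "l1_norm x = (\<Sum>b\<in>Basis. \<bar>x \<bullet> b\<bar>)"

definition selection :: "'w measure \<Rightarrow> ('w \<Rightarrow> 'a::euclidean_space set) \<Rightarrow> ('w \<Rightarrow> 'a) \<Rightarrow> bool" where
  "selection M X \<xi> \<longleftrightarrow> \<xi> \<in> borel_measurable M \<and> (AE \<omega> in M. \<xi> \<omega> \<in> X \<omega>)"

definition integrable_selections :: "'w measure \<Rightarrow> ('w \<Rightarrow> 'a::euclidean_space set) \<Rightarrow> ('w \<Rightarrow> 'a) set" where
  "integrable_selections M X = {\<xi>. selection M X \<xi> \<and> integrable M (\<lambda>\<omega>. l1_norm (\<xi> \<omega>))}"

definition integrable_set :: "'w measure \<Rightarrow> ('w \<Rightarrow> 'a::euclidean_space set) \<Rightarrow> bool" where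
  "integrable_set M X \<longleftrightarrow> integrable_selections M X \<noteq> {}"

definition selection_expectation :: "'w measure \<Rightarrow> ('w \<Rightarrow> 'a::euclidean_space set) \<Rightarrow> 'a set" where
  "selection_expectation M X = closure {integral\<^sup>L M \<xi> | \<xi>. \<xi> \<in> integrable_selections M X}"

text \<open>Almost sure boundedness of the values alone would not make the selection expectation bounded.
  The integrand is automatically measurable for a random closed set.\<close>

definition integrably_bounded :: "'w measure \<Rightarrow> ('w \<Rightarrow> 'a::euclidean_space set) \<Rightarrow> bool" where
  "integrably_bounded M X \<longleftrightarrow> (\<integral>\<^sup>+\<omega>. (SUP x\<in>X \<omega>. ennreal (l1_norm x)) \<partial>M) < \<infinity>"

definition graph_convex :: "('a::euclidean_space \<Rightarrow> 'b::euclidean_space set) \<Rightarrow> bool" where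
  "graph_convex S \<longleftrightarrow> (\<forall>u0 u1 l. 0 < l \<and> l < 1 \<longrightarrow>
     (\<lambda>y. (1 - l) *\<^sub>R y) ` S u0 + (\<lambda>y. l *\<^sub>R y) ` S u1 \<subseteq> S ((1 - l) *\<^sub>R u0 + l *\<^sub>R u1))"

definition locally_bounded :: "('a::euclidean_space \<Rightarrow> 'b::euclidean_space set) \<Rightarrow> bool" where
  "locally_bounded S \<longleftrightarrow> (\<forall>B. bounded B \<longrightarrow> bounded (\<Union>u\<in>B. S u))"

definition outer_semicontinuous_at ::
    "('a::euclidean_space \<Rightarrow> 'b::euclidean_space set) \<Rightarrow> 'a \<Rightarrow> bool" where
  "outer_semicontinuous_at S u \<longleftrightarrow>
     (\<forall>v y z. v \<longlonglongrightarrow> u \<and> (\<forall>n. y n \<in> S (v n)) \<and> y \<longlonglongrightarrow> z \<longrightarrow> z \<in> S u)"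

definition inner_semicontinuous_at ::
    "('a::euclidean_space \<Rightarrow> 'b::euclidean_space set) \<Rightarrow> 'a \<Rightarrow> bool" where
  "inner_semicontinuous_at S u \<longleftrightarrow>
     (\<forall>z\<in>S u. \<forall>v. v \<longlonglongrightarrow> u \<longrightarrow> (\<exists>y. (\<forall>n. y n \<in> S (v n)) \<and> y \<longlonglongrightarrow> z))"

definition set_valued_continuous :: "('a::euclidean_space \<Rightarrow> 'b::euclidean_space set) \<Rightarrow> bool" where
  "set_valued_continuous S \<longleftrightarrow>
     (\<forall>u. outer_semicontinuous_at S u \<and> inner_semicontinuous_at S u)"

end

theory Submission
  imports Defs
begin

text \<open>Given an integrable selection \<open>\<eta>\<close> of \<open>S(X)\<close>, choose measurably a point \<open>\<xi>(\<omega>) \<in> X(\<omega>)\<close> with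
  \<open>\<eta>(\<omega>) \<in> S(\<xi>(\<omega>))\<close>. The pair \<open>(\<xi>, \<eta>)\<close> takes values in the graph of \<open>S\<close>, which is closed and
  convex, so the graph also contains \<open>(E \<xi>, E \<eta>)\<close>. Hence \<open>E \<eta>\<close> lies in \<open>S(E(X))\<close>, and this set is
  already closed because \<open>E(X)\<close> is compact and \<open>S\<close> is locally bounded with closed graph.\<close>

section \<open>Hitting events of a random closed set\<close>

text \<open>All generators of the Fell topology consist of closed sets, hence so do its open sets,
  and the space of \<open>fell_borel\<close> is exactly the family of closed sets.\<close>

lemma random_closed_set_closed:
  assumes "random_closed_set M X" "\<omega> \<in> space M"
  shows "closed (X \<omega>)"
proof -
  have "{U. openin fell_topology U} \<subseteq> Pow {F::'b set. closed F}"
    using openin_subset[of "fell_topology :: 'b set topology"] by (fastforce simp: fell_topology_def)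
  then have "space fell_borel = {F::'b set. closed F}"
    unfolding fell_borel_def by (simp add: space_measure_of)
  then show ?thesis
    using measurable_space[OF assms[unfolded random_closed_set_def]] by auto
qed

lemma random_closed_set_hits_open:
  fixes X :: "'w \<Rightarrow> 'a::euclidean_space set"
  assumes "random_closed_set M X" "open G"
  shows "{\<omega>\<in>space M. X \<omega> \<inter> G \<noteq> {}} \<in> sets M"
proof -
  let ?H = "{F. closed F \<and> F \<inter> G \<noteq> {}}"
  have sub: "{U. openin fell_topology U} \<subseteq> Pow {F::'a set. closed F}"
    using openin_subset[of "fell_topology :: 'a set topology"] by (fastforce simp: fell_topology_def)
  have "openin fell_topology ?H"
    unfolding fell_topology_def using assms(2) by (intro topology_generated_by_Basis) blast
  then have "?H \<in> sets fell_borel"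
    unfolding fell_borel_def using sub by (simp add: sets_measure_of sigma_sets.Basic)
  then have "X -` ?H \<inter> space M \<in> sets M"
    using assms(1) unfolding random_closed_set_def by (rule measurable_sets[rotated])
  also have "X -` ?H \<inter> space M = {\<omega>\<in>space M. X \<omega> \<inter> G \<noteq> {}}"
    using random_closed_set_closed[OF assms(1)] by auto
  finally show ?thesis .
qed

text \<open>Compactness of \<open>C\<close> turns the uncountable condition into a countable one:
  \<open>X \<omega>\<close> times the point \<open>\<eta> \<omega>\<close> meets \<open>C\<close>
  iff, for every \<open>n\<close>, some point of a finite net of \<open>C\<close> is within
  \<open>1 / Suc n\<close> of it in both coordinates. For one net point this is the event that
  \<open>X\<close> hits an open ball while \<open>\<eta>\<close> lies in another.\<close>

lemma sets_Collect_section_hits_compact: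
  fixes X :: "'w \<Rightarrow> 'a::euclidean_space set" and \<eta> :: "'w \<Rightarrow> 'b::euclidean_space"
  assumes closed: "\<And>\<omega>. \<omega> \<in> space M \<Longrightarrow> closed (X \<omega>)"
    and hits: "\<And>G. open G \<Longrightarrow> {\<omega>\<in>space M. X \<omega> \<inter> G \<noteq> {}} \<in> sets M"
    and \<eta>: "\<eta> \<in> borel_measurable M"
    and "compact C"
  shows "{\<omega>\<in>space M. \<exists>u\<in>X \<omega>. (u, \<eta> \<omega>) \<in> C} \<in> sets M"
proof -
  have "\<exists>k. \<forall>n. finite (k n) \<and> k n \<subseteq> C \<and> C \<subseteq> (\<Union>x\<in>k n. ball x (1 / Suc n))"
  proof (rule choice, rule allI)
    fix n
    show "\<exists>K. finite K \<and> K \<subseteq> C \<and> C \<subseteq> (\<Union>x\<in>K. ball x (1 / Suc n))"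
      using compactE_image[OF \<open>compact C\<close>, of C "\<lambda>x. ball x (1 / Suc n)"]
      by (metis UN_I centre_in_ball open_ball of_nat_0_less_iff subsetI zero_less_Suc zero_less_divide_1_iff)
  qed
  then obtain k where fin: "\<And>n. finite (k n)" and kC: "\<And>n. k n \<subseteq> C"
    and cover: "\<And>n. C \<subseteq> (\<Union>x\<in>k n. ball x (1 / Suc n))" by blast
  have eq: "(\<exists>u\<in>X \<omega>. (u, \<eta> \<omega>) \<in> C) \<longleftrightarrow>
      (\<forall>n. \<exists>p\<in>k n. X \<omega> \<inter> ball (fst p) (1 / Suc n) \<noteq> {} \<and> \<eta> \<omega> \<in> ball (snd p) (1 / Suc n))"
    (is "?L \<longleftrightarrow> ?R") if \<omega>: "\<omega> \<in> space M" for \<omega>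
  proof
    assume ?L
    then obtain u where u: "u \<in> X \<omega>" "(u, \<eta> \<omega>) \<in> C" by blast
    show ?R
    proof
      fix n
      obtain p where p: "p \<in> k n" "dist p (u, \<eta> \<omega>) < 1 / Suc n"
        using u(2) cover[of n] by auto
      with dist_fst_le[of p "(u, \<eta> \<omega>)"] dist_snd_le[of p "(u, \<eta> \<omega>)"]
      have "u \<in> ball (fst p) (1 / Suc n)" "\<eta> \<omega> \<in> ball (snd p) (1 / Suc n)" by auto
      with u p show "\<exists>p\<in>k n. X \<omega> \<inter> ball (fst p) (1 / Suc n) \<noteq> {} \<and> \<eta> \<omega> \<in> ball (snd p) (1 / Suc n)"
        by blast
    qed
  next
    assume ?R
    \<comment> \<open>The net points \<open>p n\<close> accumulate at some \<open>l\<close> in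
      \<open>C\<close>. Along the subsequence the \<open>u n\<close> approach \<open>fst l\<close>,
      which closedness places in \<open>X \<omega>\<close>, while the second coordinates force
      \<open>snd l\<close> to be \<open>\<eta> \<omega>\<close>.\<close>
    then have "\<forall>n. \<exists>p u. p \<in> k n \<and> u \<in> X \<omega> \<and> dist (fst p) u < 1 / Suc n \<and> dist (snd p) (\<eta> \<omega>) < 1 / Suc n"
      by (fastforce simp: disjoint_iff)
    then obtain p u where p: "\<And>n. p n \<in> k n" and u: "\<And>n. u n \<in> X \<omega>"
      and d: "\<And>n. dist (fst (p n)) (u n) < 1 / Suc n" "\<And>n. dist (snd (p n)) (\<eta> \<omega>) < 1 / Suc n"
      by metis
    have "\<forall>n. p n \<in> C" using p kC by blast
    then obtain l r where l: "l \<in> C" and r: "strict_mono (r :: nat \<Rightarrow> nat)" and lim: "(p \<circ> r) \<longlonglongrightarrow> l"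
      by (rule seq_compactE[OF compact_imp_seq_compact[OF \<open>compact C\<close>]])
    have "(\<lambda>n. 1 / real (Suc n)) \<longlonglongrightarrow> 0" by (rule LIMSEQ_Suc) (rule lim_1_over_n)
    then have inv: "((\<lambda>n. 1 / real (Suc n)) \<circ> r) \<longlonglongrightarrow> 0" using r by (rule LIMSEQ_subseq_LIMSEQ)
    have "(\<lambda>n. fst (p (r n)) - u (r n)) \<longlonglongrightarrow> 0"
      by (rule Lim_null_comparison[OF _ inv]) (auto intro!: always_eventually less_imp_le d simp flip: dist_norm simp del: of_nat_Suc)
    moreover have "(\<lambda>n. fst (p (r n))) \<longlonglongrightarrow> fst l" using tendsto_fst[OF lim] by (simp add: o_def)
    ultimately have "(\<lambda>n. u (r n)) \<longlonglongrightarrow> fst l"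
      using tendsto_diff[of "\<lambda>n. fst (p (r n))" "fst l" sequentially "\<lambda>n. fst (p (r n)) - u (r n)" 0] by simp
    then have "fst l \<in> X \<omega>"
      using closed_sequentially[OF closed[OF \<omega>], of "\<lambda>n. u (r n)"] u by blast
    moreover have "(\<lambda>n. snd (p (r n)) - \<eta> \<omega>) \<longlonglongrightarrow> 0"
      by (rule Lim_null_comparison[OF _ inv]) (auto intro!: always_eventually less_imp_le d simp flip: dist_norm simp del: of_nat_Suc)
    then have "(\<lambda>n. snd (p (r n))) \<longlonglongrightarrow> \<eta> \<omega>" by (rule LIM_zero_cancel)
    moreover have "(\<lambda>n. snd (p (r n))) \<longlonglongrightarrow> snd l" using tendsto_snd[OF lim] by (simp add: o_def)
    ultimately show ?L using l LIMSEQ_unique by (metis prod.collapse)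
  qed
  have ball: "Measurable.pred M (\<lambda>\<omega>. X \<omega> \<inter> ball a e \<noteq> {} \<and> \<eta> \<omega> \<in> ball b e)" for a b e
  proof (rule pred_intros_logic(3))
    show "Measurable.pred M (\<lambda>\<omega>. X \<omega> \<inter> ball a e \<noteq> {})"
      unfolding pred_def by (rule hits) simp
    show "Measurable.pred M (\<lambda>\<omega>. \<eta> \<omega> \<in> ball b e)"
      using measurable_sets[OF \<eta>, of "ball b e"] by (simp add: pred_def vimage_def Int_def conj_commute)
  qed
  have "{\<omega>\<in>space M. \<exists>u\<in>X \<omega>. (u, \<eta> \<omega>) \<in> C} = {\<omega>\<in>space M.
      \<forall>n. \<exists>p\<in>k n. X \<omega> \<inter> ball (fst p) (1 / Suc n) \<noteq> {} \<and> \<eta> \<omega> \<in> ball (snd p) (1 / Suc n)}"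
    using eq by blast
  also have "\<dots> \<in> sets M"
    unfolding pred_def[symmetric]
    by (intro pred_intros_countable(1) pred_intros_finite(4) fin ball)
  finally show ?thesis .
qed

section \<open>Measurable selections\<close>

text \<open>Closed balls serve two ends: every stage stays closed, and hitting a compact
  \<open>K\<close> at one stage becomes hitting a smaller compact set at the stage before. Stage
  \<open>Suc n\<close> carries the radius \<open>(1/2)^n\<close>.\<close>

primrec shrink :: "(nat \<Rightarrow> 'a::metric_space) \<Rightarrow> 'a set \<Rightarrow> nat \<Rightarrow> 'a set" where
  "shrink d A 0 = A"
| "shrink d A (Suc n) =
    shrink d A n \<inter> cball (d (LEAST i. shrink d A n \<inter> cball (d i) ((1/2)^n) \<noteq> {})) ((1/2)^n)"

text \<open>As in the Kuratowski--Ryll-Nardzewski theorem, the selection is the limit of the centres of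
  small balls hitting the set, each chosen with the least possible index.\<close>

lemma measurable_selection:
  fixes F :: "'w \<Rightarrow> 'a::euclidean_space set"
  assumes closed: "\<And>\<omega>. \<omega> \<in> space M \<Longrightarrow> closed (F \<omega>)"
    and nonempty: "\<And>\<omega>. \<omega> \<in> space M \<Longrightarrow> F \<omega> \<noteq> {}"
    and hits: "\<And>K. compact K \<Longrightarrow> {\<omega>\<in>space M. F \<omega> \<inter> K \<noteq> {}} \<in> sets M"
  obtains \<xi> where "\<xi> \<in> borel_measurable M" "\<And>\<omega>. \<omega> \<in> space M \<Longrightarrow> \<xi> \<omega> \<in> F \<omega>"
proof -
  obtain D :: "'a set" where D: "countable D" "\<And>U. open U \<Longrightarrow> U \<noteq> {} \<Longrightarrow> \<exists>d\<in>D. d \<in> U"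
    using countable_dense_setE by metis
  have "D \<noteq> {}" using D(2)[of UNIV] by auto
  define d where "d = from_nat_into D"
  have dense: "\<exists>i. x \<in> cball (d i) e" if "0 < e" for x e
    using D(2)[of "ball x e"] that from_nat_into_surj[OF D(1)]
    unfolding d_def by (metis ball_eq_empty centre_in_ball dist_commute less_imp_le linorder_not_le mem_ball mem_cball open_ball)
  define L where "L = (\<lambda>n \<omega>. LEAST i. shrink d (F \<omega>) n \<inter> cball (d i) ((1/2)^n) \<noteq> {})"
  have Suc: "shrink d (F \<omega>) (Suc n) = shrink d (F \<omega>) n \<inter> cball (d (L n \<omega>)) ((1/2)^n)" for n \<omega>
    by (simp add: L_def)
  \<comment> \<open>Stated conditionally on stage \<open>n\<close>, because the induction below
    needs the measurable index at stage \<open>n\<close> in order to reach stage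
    \<open>Suc n\<close>.\<close>
  have L: "L n \<in> measurable M (count_space UNIV)"
    if "\<And>K. compact K \<Longrightarrow> Measurable.pred M (\<lambda>\<omega>. shrink d (F \<omega>) n \<inter> K \<noteq> {})" for n
    unfolding L_def by (rule measurable_Least) (rule that, simp)
  have pred: "Measurable.pred M (\<lambda>\<omega>. shrink d (F \<omega>) n \<inter> K \<noteq> {})" if "compact K" for n K
    using that
  proof (induction n arbitrary: K)
    case 0
    then show ?case using hits by (simp add: pred_def)
  next
    case (Suc n)
    \<comment> \<open>For each fixed index \<open>i\<close> the intersection of the ball with
      \<open>K\<close> is compact, so the induction hypothesis applies; the index takes countably
      many values and may then be replaced by the measurable \<open>L n \<omega>\<close>.\<close>
    have "Measurable.pred M (\<lambda>\<omega>. shrink d (F \<omega>) n \<inter> (cball (d (L n \<omega>)) ((1/2)^n) \<inter> K) \<noteq> {})"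
      by (rule measurable_compose_countable[where f = "\<lambda>i \<omega>. shrink d (F \<omega>) n \<inter> (cball (d i) ((1/2)^n) \<inter> K) \<noteq> {}"])
        (auto intro!: Suc L compact_Int)
    then show ?case unfolding \<open>\<And>\<omega> n. shrink d (F \<omega>) (Suc n) = _ n \<omega>\<close> by (simp only: Int_assoc)
  qed
  have ne: "shrink d (F \<omega>) n \<noteq> {}" if "\<omega> \<in> space M" for n \<omega>
  proof (induction n)
    case 0
    then show ?case using nonempty[OF that] by simp
  next
    case (Suc n)
    then obtain x where x: "x \<in> shrink d (F \<omega>) n" by blast
    \<comment> \<open>Density supplies an admissible index, so the least one exists and its ball
      really meets the current stage.\<close>
    obtain i where "x \<in> cball (d i) ((1/2)^n)" using dense[of "(1/2)^n" x] by auto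
    with x have "shrink d (F \<omega>) n \<inter> cball (d i) ((1/2)^n) \<noteq> {}" by blast
    then have "shrink d (F \<omega>) n \<inter> cball (d (L n \<omega>)) ((1/2)^n) \<noteq> {}"
      unfolding L_def by (rule LeastI)
    then show ?case by (simp only: \<open>\<And>\<omega> n. shrink d (F \<omega>) (Suc n) = _ n \<omega>\<close> not_False_eq_True)
  qed
  have cl: "closed (shrink d (F \<omega>) n)" if "\<omega> \<in> space M" for n \<omega>
    by (induction n) (auto simp: closed[OF that])
  have small: "(\<lambda>n. (1/2::real)^n) \<longlonglongrightarrow> 0" by (rule LIMSEQ_power_zero) simp
  have "\<exists>a. \<forall>n. a \<in> shrink d (F \<omega>) n" if \<omega>: "\<omega> \<in> space M" for \<omega>
  proof (rule decreasing_closed_nest[of "shrink d (F \<omega>)"])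
    fix m n :: nat assume "m \<le> n"
    then show "shrink d (F \<omega>) n \<subseteq> shrink d (F \<omega>) m"
      by (rule lift_Suc_antimono_le[rotated]) auto
  next
    fix e :: real assume "0 < e"
    \<comment> \<open>Cantor's nested set argument: stage \<open>Suc n\<close> lies in a ball of
      radius \<open>(1/2)^n\<close>, so its diameter is at most twice that radius.\<close>
    then obtain n where n: "(1/2)^n < e / 2"
      using order_tendstoD(2)[OF small, of "e / 2"] by (auto simp: eventually_sequentially)
    have "dist x y < e" if "x \<in> shrink d (F \<omega>) (Suc n)" "y \<in> shrink d (F \<omega>) (Suc n)" for x y
      using that n dist_triangle3[of x y "d (L n \<omega>)"] unfolding Suc by auto
    then show "\<exists>n. \<forall>x\<in>shrink d (F \<omega>) n. \<forall>y\<in>shrink d (F \<omega>) n. dist x y < e" by blast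
  qed (use cl ne \<omega> in auto)
  then obtain \<xi> where \<xi>: "\<And>\<omega> n. \<omega> \<in> space M \<Longrightarrow> \<xi> \<omega> \<in> shrink d (F \<omega>) n" by metis
  have "\<xi> \<in> borel_measurable M"
  proof (rule borel_measurable_LIMSEQ_metric)
    show "(\<lambda>\<omega>. d (L n \<omega>)) \<in> borel_measurable M" for n
      by (rule measurable_compose[OF L[OF pred]]) simp_all
    fix \<omega> assume "\<omega> \<in> space M"
    then have "dist (d (L n \<omega>)) (\<xi> \<omega>) \<le> (1/2)^n" for n
      using \<xi>[of \<omega> "Suc n"] unfolding Suc by simp
    then show "(\<lambda>n. d (L n \<omega>)) \<longlonglongrightarrow> \<xi> \<omega>"
      using Lim_null_comparison[OF _ small, of "\<lambda>n. d (L n \<omega>) - \<xi> \<omega>"]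
      by (auto simp: dist_norm intro: LIM_zero_cancel)
  qed
  moreover have "\<xi> \<omega> \<in> F \<omega>" if "\<omega> \<in> space M" for \<omega>
    using \<xi>[OF that, of 0] by simp
  ultimately show thesis by (rule that)
qed

text \<open>A measurable implicit function lemma in the style of Filippov. The section of
  \<open>G\<close> at \<open>\<eta> \<omega>\<close>, cut with \<open>X \<omega>\<close>, is closed;
  it hits a compact \<open>K\<close> iff \<open>X \<omega>\<close> times
  \<open>\<eta> \<omega>\<close> meets the compact set \<open>G \<inter> K \<times> UNIV\<close>, an
  event by the lemma on compact \<open>C\<close>.\<close>

lemma measurable_section_selection:
  fixes X :: "'w \<Rightarrow> 'a::euclidean_space set" and \<eta> :: "'w \<Rightarrow> 'b::euclidean_space"
  assumes X: "random_closed_set M X"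
    and \<eta>: "\<eta> \<in> borel_measurable M"
    and "closed G"
    and compact: "\<And>K. compact K \<Longrightarrow> compact (G \<inter> K \<times> UNIV)"
    and ae: "AE \<omega> in M. \<exists>u\<in>X \<omega>. (u, \<eta> \<omega>) \<in> G"
  obtains \<xi> where "\<xi> \<in> borel_measurable M" "AE \<omega> in M. \<xi> \<omega> \<in> X \<omega> \<and> (\<xi> \<omega>, \<eta> \<omega>) \<in> G"
proof -
  define F where "F = (\<lambda>\<omega>. {u \<in> X \<omega>. (u, \<eta> \<omega>) \<in> G})"
  \<comment> \<open>Selecting requires nonempty values at every point, so \<open>{0}\<close> is
    substituted on the exceptional null set where no suitable \<open>u\<close> exists.\<close>
  define F' where "F' = (\<lambda>\<omega>. if F \<omega> = {} then {0} else F \<omega>)"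
  have hits: "Measurable.pred M (\<lambda>\<omega>. F \<omega> \<inter> K \<noteq> {})" if "compact K" for K
  proof -
    have "(F \<omega> \<inter> K \<noteq> {}) = (\<exists>u\<in>X \<omega>. (u, \<eta> \<omega>) \<in> G \<inter> K \<times> UNIV)" for \<omega>
      by (auto simp: F_def)
    then show ?thesis
      using sets_Collect_section_hits_compact[OF random_closed_set_closed[OF X]
          random_closed_set_hits_open[OF X] \<eta> compact[OF that]]
      by (simp add: pred_def)
  qed
  \<comment> \<open>Measurability is known for compact test sets only, so nonemptiness is tested on
    countably many balls exhausting the space.\<close>
  have "(F \<omega> \<noteq> {}) = (\<exists>n::nat. F \<omega> \<inter> cball 0 (real n) \<noteq> {})" for \<omega>
    using real_arch_simple by (fastforce simp: disjoint_iff)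
  moreover have "Measurable.pred M (\<lambda>\<omega>. \<exists>n::nat. F \<omega> \<inter> cball 0 (real n) \<noteq> {})"
    by (intro pred_intros_countable(2) hits compact_cball)
  ultimately have "Measurable.pred M (\<lambda>\<omega>. F \<omega> \<noteq> {})" by simp
  from pred_intros_logic(2)[OF this] have empty: "Measurable.pred M (\<lambda>\<omega>. F \<omega> = {})"
    by (simp only: not_not)
  have closed: "closed (F \<omega>)" if "\<omega> \<in> space M" for \<omega>
  proof -
    have "closed ((\<lambda>u. (u, \<eta> \<omega>)) -` G)"
      using \<open>closed G\<close> by (intro closed_vimage continuous_intros)
    moreover have "F \<omega> = X \<omega> \<inter> (\<lambda>u. (u, \<eta> \<omega>)) -` G" by (auto simp: F_def)
    ultimately show ?thesis using random_closed_set_closed[OF X that] by auto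
  qed
  have hits': "{\<omega>\<in>space M. F' \<omega> \<inter> K \<noteq> {}} \<in> sets M" if "compact K" for K
  proof -
    have "(F' \<omega> \<inter> K \<noteq> {}) = (F \<omega> \<inter> K \<noteq> {} \<or> F \<omega> = {} \<and> 0 \<in> K)" for \<omega>
      by (auto simp: F'_def)
    moreover have "Measurable.pred M (\<lambda>\<omega>. F \<omega> \<inter> K \<noteq> {} \<or> F \<omega> = {} \<and> 0 \<in> K)"
      by (intro pred_intros_logic(5) pred_intros_conj2' hits[OF that] empty)
    ultimately show ?thesis by (simp only: pred_def)
  qed
  obtain \<xi> where \<xi>: "\<xi> \<in> borel_measurable M" "\<And>\<omega>. \<omega> \<in> space M \<Longrightarrow> \<xi> \<omega> \<in> F' \<omega>"
  proof (rule measurable_selection[of M F'])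
    show "closed (F' \<omega>)" "F' \<omega> \<noteq> {}" if "\<omega> \<in> space M" for \<omega>
      using closed[OF that] by (auto simp: F'_def)
  qed (use hits' in auto)
  have "AE \<omega> in M. \<xi> \<omega> \<in> X \<omega> \<and> (\<xi> \<omega>, \<eta> \<omega>) \<in> G"
    using ae AE_space
  proof eventually_elim
    case (elim \<omega>)
    then show ?case using \<xi>(2)[of \<omega>] by (auto simp: F'_def F_def split: if_splits)
  qed
  with \<xi>(1) show thesis by (rule that)
qed

section \<open>Expectations and closed convex sets\<close>

text \<open>An expectation outside \<open>C\<close> could be strictly separated from
  \<open>C\<close> by a hyperplane; integrating the separating functional along \<open>Z\<close>
  contradicts this.\<close>

lemma (in prob_space) expectation_in_closed_convex:
  fixes Z :: "'a \<Rightarrow> 'c::euclidean_space"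
  assumes "integrable M Z" "closed C" "convex C" "AE \<omega> in M. Z \<omega> \<in> C"
  shows "expectation Z \<in> C"
proof (rule ccontr)
  assume "expectation Z \<notin> C"
  then obtain a b where ab: "a \<bullet> expectation Z < b" "\<And>x. x \<in> C \<Longrightarrow> b < a \<bullet> x"
    using separating_hyperplane_closed_point[OF assms(3,2)] by blast
  have "b \<le> expectation (\<lambda>\<omega>. a \<bullet> Z \<omega>)"
    using assms(1,4) by (intro integral_ge_const) (auto dest: ab(2) elim!: eventually_mono)
  with ab(1) show False using assms(1) by simp
qed

lemma (in prob_space) expectation_pair_in_closed_convex:
  fixes \<xi> :: "'a \<Rightarrow> 'b::euclidean_space" and \<eta> :: "'a \<Rightarrow> 'c::euclidean_space"
  assumes \<xi>: "integrable M \<xi>" and \<eta>: "integrable M \<eta>"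
    and "closed C" "convex C" "AE \<omega> in M. (\<xi> \<omega>, \<eta> \<omega>) \<in> C"
  shows "(expectation \<xi>, expectation \<eta>) \<in> C"
proof -
  have Z: "integrable M (\<lambda>\<omega>. (\<xi> \<omega>, \<eta> \<omega>))"
    by (rule Bochner_Integration.integrable_bound[of M "\<lambda>\<omega>. norm (\<xi> \<omega>) + norm (\<eta> \<omega>)"])
      (use \<xi> \<eta> norm_Pair_le in \<open>auto intro!: borel_measurable_Pair\<close>)
  have "expectation (\<lambda>\<omega>. (\<xi> \<omega>, \<eta> \<omega>)) = (expectation \<xi>, expectation \<eta>)"
    using integral_bounded_linear[OF bounded_linear_fst Z] integral_bounded_linear[OF bounded_linear_snd Z]
    by (simp add: prod_eq_iff)
  with expectation_in_closed_convex[OF Z assms(3-5)] show ?thesis by simp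
qed

section \<open>Integrable selections and the size of the selection expectation\<close>

lemma norm_le_l1_norm: "norm x \<le> l1_norm x"
  unfolding l1_norm_def by (rule norm_le_l1)

lemma l1_norm_nonneg: "0 \<le> l1_norm x"
  unfolding l1_norm_def by (simp add: sum_nonneg)

lemma borel_measurable_l1_norm [measurable]: "l1_norm \<in> borel_measurable borel"
  unfolding l1_norm_def[abs_def] by measurable

lemma integrable_selectionsD:
  assumes "\<xi> \<in> integrable_selections M X"
  shows "\<xi> \<in> borel_measurable M" "AE \<omega> in M. \<xi> \<omega> \<in> X \<omega>" "integrable M \<xi>"
proof -
  show meas: "\<xi> \<in> borel_measurable M" and "AE \<omega> in M. \<xi> \<omega> \<in> X \<omega>"
    using assms by (auto simp: integrable_selections_def selection_def)
  have "integrable M (\<lambda>\<omega>. l1_norm (\<xi> \<omega>))"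
    using assms by (simp add: integrable_selections_def)
  then show "integrable M \<xi>"
    using meas by (rule Bochner_Integration.integrable_bound) (simp add: norm_le_l1_norm l1_norm_nonneg)
qed

lemma nn_integral_l1_norm_selection_le:
  assumes "selection M X \<xi>"
  shows "(\<integral>\<^sup>+\<omega>. ennreal (l1_norm (\<xi> \<omega>)) \<partial>M) \<le> (\<integral>\<^sup>+\<omega>. (SUP x\<in>X \<omega>. ennreal (l1_norm x)) \<partial>M)"
  using assms unfolding selection_def
  by (intro nn_integral_mono_AE) (auto intro: SUP_upper elim!: eventually_mono)

text \<open>Makes the measurably chosen \<open>\<xi>\<close> of the main proof integrable, its norm
  being dominated by the supremum over \<open>X \<omega>\<close>.\<close>

lemma integrably_bounded_selection_integrable:
  assumes "integrably_bounded M X" "selection M X \<xi>"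
  shows "\<xi> \<in> integrable_selections M X"
proof -
  have [measurable]: "\<xi> \<in> borel_measurable M" using assms(2) by (simp add: selection_def)
  have "(\<integral>\<^sup>+\<omega>. ennreal (norm (l1_norm (\<xi> \<omega>))) \<partial>M) < \<infinity>"
    using nn_integral_l1_norm_selection_le[OF assms(2)] assms(1)
    by (simp add: integrably_bounded_def l1_norm_nonneg)
  then have "integrable M (\<lambda>\<omega>. l1_norm (\<xi> \<omega>))" by (intro integrableI_bounded) measurable
  then show ?thesis using assms(2) by (simp add: integrable_selections_def)
qed

text \<open>The single bound \<open>?B\<close> dominates all selections at once, so their
  expectations fill a bounded set, whose closure is compact in a Euclidean space.\<close>

lemma compact_selection_expectation:
  fixes X :: "'w \<Rightarrow> 'a::euclidean_space set"
  assumes "integrably_bounded M X"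
  shows "compact (selection_expectation M X)"
proof -
  let ?B = "\<integral>\<^sup>+\<omega>. (SUP x\<in>X \<omega>. ennreal (l1_norm x)) \<partial>M"
  have fin: "?B < \<infinity>" using assms by (simp add: integrably_bounded_def)
  have "norm (integral\<^sup>L M \<xi>) \<le> enn2real ?B" if \<xi>: "\<xi> \<in> integrable_selections M X" for \<xi>
  proof -
    have int: "integrable M (\<lambda>\<omega>. l1_norm (\<xi> \<omega>))" and sel: "selection M X \<xi>"
      using \<xi> by (auto simp: integrable_selections_def)
    have "norm (integral\<^sup>L M \<xi>) \<le> (\<integral>\<omega>. norm (\<xi> \<omega>) \<partial>M)" by (rule integral_norm_bound)
    also have "\<dots> \<le> (\<integral>\<omega>. l1_norm (\<xi> \<omega>) \<partial>M)"
      using integrable_selectionsD(3)[OF \<xi>] int by (intro integral_mono norm_le_l1_norm) auto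
    also have "\<dots> = enn2real (\<integral>\<^sup>+\<omega>. ennreal (l1_norm (\<xi> \<omega>)) \<partial>M)"
      using int by (intro integral_eq_nn_integral) (auto simp: l1_norm_nonneg)
    also have "\<dots> \<le> enn2real ?B"
      using nn_integral_l1_norm_selection_le[OF sel] fin by (intro enn2real_mono) auto
    finally show ?thesis .
  qed
  then have "bounded {integral\<^sup>L M \<xi> | \<xi>. \<xi> \<in> integrable_selections M X}"
    by (auto simp: bounded_iff)
  then show ?thesis unfolding selection_expectation_def by (simp add: compact_closure)
qed

section \<open>The graph of a set-valued function\<close>

lemma closed_graph:
  assumes "\<And>u. outer_semicontinuous_at S u"
  shows "closed {(u, y). y \<in> S u}"
  unfolding closed_sequential_limits
proof (intro allI impI, elim conjE)
  fix p l assume p: "\<forall>n. p n \<in> {(u, y). y \<in> S u}" and "p \<longlonglongrightarrow> l"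
  then have "(\<lambda>n. fst (p n)) \<longlonglongrightarrow> fst l" "(\<lambda>n. snd (p n)) \<longlonglongrightarrow> snd l"
    by (auto intro: tendsto_fst tendsto_snd)
  moreover have "\<forall>n. snd (p n) \<in> S (fst (p n))" using p by (simp add: case_prod_unfold)
  ultimately have "snd l \<in> S (fst l)" 
    using assms[of "fst l", unfolded outer_semicontinuous_at_def, rule_format,
        of "\<lambda>n. fst (p n)" "\<lambda>n. snd (p n)" "snd l"] by blast
  then show "l \<in> {(u, y). y \<in> S u}" by (simp add: case_prod_unfold)
qed

lemma convex_graph:
  assumes "graph_convex S"
  shows "convex {(u, y). y \<in> S u}"
  unfolding convex_alt
proof (intro ballI allI impI, elim conjE)
  fix p q and l :: real
  assume pq: "p \<in> {(u, y). y \<in> S u}" "q \<in> {(u, y). y \<in> S u}" and l: "0 \<le> l" "l \<le> 1"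
  show "(1 - l) *\<^sub>R p + l *\<^sub>R q \<in> {(u, y). y \<in> S u}"
  \<comment> \<open>\<open>graph_convex\<close> speaks of weights strictly between 0 and 1; at the
    end points the combination is \<open>p\<close> or \<open>q\<close> itself.\<close>
  proof (cases "l = 0 \<or> l = 1")
    case True
    then show ?thesis using pq by auto
  next
    case False
    with l have "(\<lambda>y. (1 - l) *\<^sub>R y) ` S (fst p) + (\<lambda>y. l *\<^sub>R y) ` S (fst q)
        \<subseteq> S ((1 - l) *\<^sub>R fst p + l *\<^sub>R fst q)"
      using assms by (simp add: graph_convex_def)
    moreover have "(1 - l) *\<^sub>R snd p + l *\<^sub>R snd q \<in> (\<lambda>y. (1 - l) *\<^sub>R y) ` S (fst p) + (\<lambda>y. l *\<^sub>R y) ` S (fst q)"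
      using pq by (intro set_plus_intro) auto
    ultimately show ?thesis by (auto simp: case_prod_unfold)
  qed
qed

text \<open>Local boundedness confines the part of the graph over \<open>K\<close> to the compact
  box \<open>K \<times> ?B\<close>, in which the graph is closed.\<close>

lemma compact_graph_over_compact:
  assumes "\<And>u. outer_semicontinuous_at S u" "locally_bounded S" "compact K"
  shows "compact ({(u, y). y \<in> S u} \<inter> K \<times> UNIV)"
proof -
  let ?B = "closure (\<Union>u\<in>K. S u)"
  have "compact ?B"
    using assms(2,3) by (simp add: locally_bounded_def compact_imp_bounded compact_closure)
  then have "compact ({(u, y). y \<in> S u} \<inter> K \<times> ?B)"
    using assms by (intro closed_Int_compact closed_graph compact_Times)
  moreover have "{(u, y). y \<in> S u} \<inter> K \<times> UNIV = {(u, y). y \<in> S u} \<inter> K \<times> ?B"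
    using closure_subset[of "\<Union>u\<in>K. S u"] by auto
  ultimately show ?thesis by simp
qed

text \<open>The union is the projection of the compact part of the graph over
  \<open>K\<close>.\<close>

lemma compact_UN_compact:
  assumes "\<And>u. outer_semicontinuous_at S u" "locally_bounded S" "compact K"
  shows "compact (\<Union>u\<in>K. S u)"
proof -
  have "compact (snd ` ({(u, y). y \<in> S u} \<inter> K \<times> UNIV))"
    using compact_graph_over_compact[OF assms]
    by (rule compact_continuous_image[rotated]) (intro continuous_intros)
  also have "snd ` ({(u, y). y \<in> S u} \<inter> K \<times> UNIV) = (\<Union>u\<in>K. S u)" by force
  finally show ?thesis .
qed

theorem proposition2:
  fixes M :: "'w measure"
    and S :: "'a::euclidean_space \<Rightarrow> 'b::euclidean_space set"
    and X :: "'w \<Rightarrow> 'a set"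
  assumes "prob_space M" and "complete_measure M"
    and "graph_convex S"
    and "random_closed_set M X" and "integrable_set M X" and "integrably_bounded M X"
    and "locally_bounded S" and "set_valued_continuous S"
  shows "selection_expectation M (\<lambda>\<omega>. \<Union>u\<in>X \<omega>. S u) \<subseteq> (\<Union>u\<in>selection_expectation M X. S u)"
proof -
  interpret prob_space M by fact
  let ?G = "{(u, y). y \<in> S u}"
  have osc: "outer_semicontinuous_at S u" for u
    using assms(8) by (simp add: set_valued_continuous_def)
  have "expectation \<eta> \<in> (\<Union>u\<in>selection_expectation M X. S u)"
    if \<eta>: "\<eta> \<in> integrable_selections M (\<lambda>\<omega>. \<Union>u\<in>X \<omega>. S u)" for \<eta>
  proof -
    have "AE \<omega> in M. \<exists>u\<in>X \<omega>. (u, \<eta> \<omega>) \<in> ?G"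
      using integrable_selectionsD(2)[OF \<eta>] by (auto elim: eventually_mono)
    then obtain \<xi> where \<xi>: "\<xi> \<in> borel_measurable M" "AE \<omega> in M. \<xi> \<omega> \<in> X \<omega> \<and> (\<xi> \<omega>, \<eta> \<omega>) \<in> ?G"
      using measurable_section_selection[OF assms(4) integrable_selectionsD(1)[OF \<eta>] closed_graph[OF osc]
          compact_graph_over_compact[OF osc assms(7)]] by blast
    then have "\<xi> \<in> integrable_selections M X"
      by (intro integrably_bounded_selection_integrable[OF assms(6)]) (auto simp: selection_def elim: eventually_mono)
    moreover from this have "(expectation \<xi>, expectation \<eta>) \<in> ?G"
      using \<xi>(2) integrable_selectionsD(3)[OF \<eta>] integrable_selectionsD(3)[of \<xi>]
      by (intro expectation_pair_in_closed_convex closed_graph osc convex_graph assms(3))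
        (auto elim: eventually_mono)
    moreover have "expectation \<xi> \<in> selection_expectation M X"
      unfolding selection_expectation_def using \<open>\<xi> \<in> integrable_selections M X\<close> by (intro subsetD[OF closure_subset]) blast
    ultimately show ?thesis by blast
  qed
  \<comment> \<open>The left-hand side is a closure of expectations, so closedness is what carries
    the inclusion from single \<open>\<eta>\<close> to limits.\<close>
  moreover have "closed (\<Union>u\<in>selection_expectation M X. S u)"
    by (intro compact_imp_closed compact_UN_compact osc assms(7) compact_selection_expectation assms(6))
  ultimately show ?thesis
    unfolding selection_expectation_def[of M "\<lambda>\<omega>. \<Union>u\<in>X \<omega>. S u"] by (intro closure_minimal) auto
qed

end
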